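(* Let $\varepsilon_1,\varepsilon_2\in\mathbb{C}$ be constants, put $\alpha_0=1-\varepsilon_1+\varepsilon_2$ and $\alpha_1=\varepsilon_1-\varepsilon_2$, and let $x,y,z,w,q,p$ be functions of $t,s$. Define $$-A=\begin{pmatrix}\varepsilon_1&y\\0&\varepsilon_2\end{pmatrix}+\begin{pmatrix}2z&4q\\-x&-2z\end{pmatrix}T+\begin{pmatrix}8p&-8\\-4w&-8p\end{pmatrix}T^2+\begin{pmatrix}0&0\\-8&0\end{pmatrix}T^3,$$ $$B_1=\begin{pmatrix}p&-1\\0&-p\end{pmatrix}+\begin{pmatrix}0&0\\-1&0\end{pmatrix}T,\qquad B_3=4\left[\begin{pmatrix}\frac z4&\frac q2\\0&-\frac z4\end{pmatrix}+\begin{pmatrix}p&-1\\-\frac w2&-p\end{pmatrix}T+\begin{pmatrix}0&0\\-1&0\end{pmatrix}T^2\right].$$ Then: (1) the compatibility condition $\partial_tA-T\partial_TB_1+[A,B_1]=0$ (identically in $T$) of the linear equations $T\partial_T\vec u=A\vec u$, $\partial_t\vec u=B_1\vec u$ is equivalent to $$\partial_tx=-2xp-\alpha_0,\ \partial_ty=2yp+\alpha_1,\ \partial_tz=\tfrac{x+y}{2},\ \partial_tw=z-2wp,\ \partial_tq=z+2qp,\ \partial_tp=\tfrac{w+q}{2};$$ (2) the compatibility condition $\partial_sA-T\partial_TB_3+[A,B_3]=0$ (identically in $T$) of the linear equations $T\partial_T\vec u=A\vec u$, $\partial_s\vec u=B_3\vec u$ is equivalent to $$\partial_sx=-2xz-2\alpha_0w,\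 \partial_sy=2yz-2\alpha_1q,\ \partial_sz=-xq+yw-2p,\ \partial_sw=-2xp-2\alpha_0-\alpha_1,\ \partial_sq=2yp+\alpha_0+2\alpha_1,\ \partial_sp=\tfrac{x+y}{2}.$$
   Context: $[A,B]=AB-BA$; $T$ is an independent (spectral) variable and $\vec u=(u_1,u_2)^{\mathsf T}$. The functions $x,\dots,p$ do not depend on $T$. Note that $\alpha_0+\alpha_1=1$. *)

theory Defs
  imports "HOL-Analysis.Analysis"
begin

definition mat22 :: "'a::zero \<Rightarrow> 'a \<Rightarrow> 'a \<Rightarrow> 'a \<Rightarrow> 'a^2^2" where
  "mat22 a b c d = vector [vector [a, b], vector [c, d]]"

definition mat_smult :: "'a::times \<Rightarrow> 'a^'n^'m \<Rightarrow> 'a^'n^'m"  (infixr \<open>*\<^sub>m\<close> 75) where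
  "c *\<^sub>m M = (\<chi> i j. c * M $ i $ j)"

definition commutator :: "'a::ring_1^'n^'n \<Rightarrow> 'a^'n^'n \<Rightarrow> 'a^'n^'n" where
  "commutator A B = A ** B - B ** A"

text \<open>Entrywise complex derivative of a matrix-valued function of one complex variable.\<close>

definition mat_deriv :: "(complex \<Rightarrow> complex^'n^'m) \<Rightarrow> complex \<Rightarrow> complex^'n^'m" where
  "mat_deriv F a = (\<chi> i j. deriv (\<lambda>u. F u $ i $ j) a)"

definition partial_t :: "(complex \<Rightarrow> complex \<Rightarrow> complex) \<Rightarrow> complex \<Rightarrow> complex \<Rightarrow> complex" where
  "partial_t f t s = deriv (\<lambda>t'. f t' s) t"

definition partial_s :: "(complex \<Rightarrow> complex \<Rightarrow> complex) \<Rightarrow> complex \<Rightarrow> complex \<Rightarrow> complex" where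
  "partial_s f t s = deriv (\<lambda>s'. f t s') s"

text \<open>
  On an open set, complex differentiability in each variable separately is the same as
  holomorphy in both variables (Hartogs).  Functions are total, but on an open \<open>D\<close> only
  their values on \<open>D\<close> matter.
\<close>

definition holomorphic2_on ::
  "(complex \<Rightarrow> complex \<Rightarrow> complex) \<Rightarrow> (complex \<times> complex) set \<Rightarrow> bool" where
  "holomorphic2_on f D \<longleftrightarrow>
     (\<forall>(t, s)\<in>D. (\<lambda>t'. f t' s) field_differentiable (at t) \<and>
                 (\<lambda>s'. f t s') field_differentiable (at s))"

text \<open>
  The Lax matrices as functions of \<open>t\<close>, \<open>s\<close> and the spectral variable \<open>T\<close> (in this order).
\<close>

definition lax_A ::
  "complex \<Rightarrow> complex \<Rightarrow>
   (complex \<Rightarrow> complex \<Rightarrow> complex) \<Rightarrow> (complex \<Rightarrow> complex \<Rightarrow> complex) \<Rightarrow>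
   (complex \<Rightarrow> complex \<Rightarrow> complex) \<Rightarrow> (complex \<Rightarrow> complex \<Rightarrow> complex) \<Rightarrow>
   (complex \<Rightarrow> complex \<Rightarrow> complex) \<Rightarrow> (complex \<Rightarrow> complex \<Rightarrow> complex) \<Rightarrow>
   complex \<Rightarrow> complex \<Rightarrow> complex \<Rightarrow> complex^2^2" where
  "lax_A \<epsilon>\<^sub>1 \<epsilon>\<^sub>2 x y z w q p t s T =
     - (mat22 \<epsilon>\<^sub>1 (y t s)
              0  \<epsilon>\<^sub>2
        + T *\<^sub>m mat22 (2 * z t s) (4 * q t s)
                     (- x t s)   (- 2 * z t s)
        + T\<^sup>2 *\<^sub>m mat22 (8 * p t s)   (- 8)
                      (- 4 * w t s) (- 8 * p t s)
        + T ^ 3 *\<^sub>m mat22 0     0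
                         (- 8) 0)"

definition lax_B1 ::
  "(complex \<Rightarrow> complex \<Rightarrow> complex) \<Rightarrow> complex \<Rightarrow> complex \<Rightarrow> complex \<Rightarrow> complex^2^2" where
  "lax_B1 p t s T =
     mat22 (p t s) (- 1)
           0       (- p t s)
     + T *\<^sub>m mat22 0     0
                  (- 1) 0"

definition lax_B3 ::
  "(complex \<Rightarrow> complex \<Rightarrow> complex) \<Rightarrow> (complex \<Rightarrow> complex \<Rightarrow> complex) \<Rightarrow>
   (complex \<Rightarrow> complex \<Rightarrow> complex) \<Rightarrow> (complex \<Rightarrow> complex \<Rightarrow> complex) \<Rightarrow>
   complex \<Rightarrow> complex \<Rightarrow> complex \<Rightarrow> complex^2^2" where
  "lax_B3 z w q p t s T =
     4 *\<^sub>m (mat22 (z t s / 4) (q t s / 2)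
                 0           (- z t s / 4)
           + T *\<^sub>m mat22 (p t s)       (- 1)
                        (- w t s / 2) (- p t s)
           + T\<^sup>2 *\<^sub>m mat22 0     0
                         (- 1) 0)"

end

(*
  The left-hand side of either compatibility condition is a matrix of polynomials in T in which
  all powers of T that do not carry a derivative cancel.  What remains has one
  coefficient per unknown function, namely the difference of the two sides of its
  evolution equation, so the condition holds for all T iff all six differences vanish.
*)
theory Submission
  imports Defs
begin

lemma mat22_nth [simp]:
  "mat22 a b c d $ 1 $ 1 = a" "mat22 a b c d $ 1 $ 2 = b"
  "mat22 a b c d $ 2 $ 1 = c" "mat22 a b c d $ 2 $ 2 = d"
  by (simp_all add: mat22_def)

lemma mat22_eqI:
  assumes "M $ 1 $ 1 = a" "M $ 1 $ 2 = b" "M $ 2 $ 1 = c" "M $ 2 $ 2 = d"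
  shows "M = mat22 a b c d"
  using assms by (simp add: vec_eq_iff forall_2)

text \<open>Applied as a rule to an equation between two explicit matrices, it leaves four scalar
  identities that can be settled separately.\<close>

lemma mat22_cong:
  "a = a' \<Longrightarrow> b = b' \<Longrightarrow> c = c' \<Longrightarrow> d = d' \<Longrightarrow> mat22 a b c d = mat22 a' b' c' d'"
  by simp

lemma mat22_eq_0_iff: "mat22 a b c d = 0 \<longleftrightarrow> a = 0 \<and> b = 0 \<and> c = 0 \<and> d = 0"
  by (auto simp: vec_eq_iff forall_2)

lemma mat22_add: "mat22 a b c d + mat22 a' b' c' d' = mat22 (a + a') (b + b') (c + c') (d + d')"
  by (rule mat22_eqI) simp_all

lemma mat22_diff:
  fixes a b c d :: "'a::group_add"
  shows "mat22 a b c d - mat22 a' b' c' d' = mat22 (a - a') (b - b') (c - c') (d - d')"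
  by (rule mat22_eqI) simp_all

lemma mat22_uminus:
  fixes a b c d :: "'a::group_add"
  shows "- mat22 a b c d = mat22 (- a) (- b) (- c) (- d)"
  by (rule mat22_eqI) simp_all

lemma mat22_smult:
  fixes k :: "'a::mult_zero"
  shows "k *\<^sub>m mat22 a b c d = mat22 (k * a) (k * b) (k * c) (k * d)"
  by (rule mat22_eqI) (simp_all add: mat_smult_def)

text \<open>Commutativity cancels \<open>a * a'\<close> and \<open>d * d'\<close>, so the diagonal
  is traceless and the off-diagonal entries see the diagonals only through \<open>a - d\<close> and
  \<open>a' - d'\<close>. Hence the constants of the Lax matrix enter only as
  \<open>\<epsilon>\<^sub>1 - \<epsilon>\<^sub>2\<close>.\<close>

lemma commutator_mat22:
  fixes a b c d :: "'a::comm_ring_1"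
  shows "commutator (mat22 a b c d) (mat22 a' b' c' d') =
    mat22 (b * c' - b' * c) ((a - d) * b' + b * (d' - a'))
          ((d - a) * c' + c * (a' - d')) (b' * c - b * c')"
  by (rule mat22_eqI)
     (simp_all add: commutator_def matrix_matrix_mult_def sum_2 algebra_simps)

lemma mat_deriv_mat22:
  assumes "(a has_field_derivative a') (at u)" "(b has_field_derivative b') (at u)"
    and "(c has_field_derivative c') (at u)" "(d has_field_derivative d') (at u)"
  shows "mat_deriv (\<lambda>u. mat22 (a u) (b u) (c u) (d u)) u = mat22 a' b' c' d'"
  by (rule mat22_eqI) (use assms in \<open>simp_all add: mat_deriv_def DERIV_imp_deriv\<close>)

text \<open>The value at \<open>T = 0\<close> isolates \<open>a\<close>, and the value at
  \<open>T = 1\<close> then gives \<open>b\<close>.\<close>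

lemma linear_poly_eq_0_iff:
  fixes a b :: "'a::comm_ring_1"
  shows "(\<forall>T. a + b * T = 0) \<longleftrightarrow> a = 0 \<and> b = 0"
proof
  assume h: "\<forall>T. a + b * T = 0"
  show "a = 0 \<and> b = 0" using h[rule_format, of 0] h[rule_format, of 1] by simp
qed simp

text \<open>The point \<open>T = 0\<close> carries no information here. The points 1 and -1 give
  \<open>a + b = 0\<close> and \<open>b - a = 0\<close>, and 2 is invertible in characteristic
  0.\<close>

lemma quadratic_poly_no_constant_eq_0_iff:
  fixes a b :: "'a::field_char_0"
  shows "(\<forall>T. a * T + b * T\<^sup>2 = 0) \<longleftrightarrow> a = 0 \<and> b = 0"
proof
  assume h: "\<forall>T. a * T + b * T\<^sup>2 = 0"
  have "a + b = 0" "b - a = 0" using h[rule_format, of 1] h[rule_format, of "-1"] by simp_all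
  then have "2 * a = 0" "b = a" by (simp_all add: algebra_simps)
  then show "a = 0 \<and> b = 0" by simp
qed simp

text \<open>This is the derivative of \<open>lax_A\<close> with respect to \<open>t\<close> or
  \<open>s\<close>, with the six derivatives replaced by the arguments. These will be the
  differences between the two sides of the evolution equations. Minus signs sit inside the
  coefficients so that each entry has the shape of a polynomial lemma above.\<close>

definition residual ::
  "complex \<Rightarrow> complex \<Rightarrow> complex \<Rightarrow> complex \<Rightarrow> complex \<Rightarrow> complex \<Rightarrow> complex \<Rightarrow> complex^2^2" where
  "residual dx dy dz dw dq dp T =
     mat22 ((- 2 * dz) * T + (- 8 * dp) * T\<^sup>2) (- dy + (- 4 * dq) * T)
           (dx * T + (4 * dw) * T\<^sup>2) (2 * dz * T + 8 * dp * T\<^sup>2)"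

text \<open>Each argument is, up to a nonzero factor, the whole coefficient of one power of
  \<open>T\<close> in some entry; the two diagonal entries yield the same conditions on
  \<open>dz\<close> and \<open>dp\<close>.\<close>

lemma residual_eq_0_iff:
  "(\<forall>T. residual dx dy dz dw dq dp T = 0) \<longleftrightarrow>
    dx = 0 \<and> dy = 0 \<and> dz = 0 \<and> dw = 0 \<and> dq = 0 \<and> dp = 0"
  unfolding residual_def mat22_eq_0_iff all_conj_distrib
    linear_poly_eq_0_iff quadratic_poly_no_constant_eq_0_iff
  by auto

lemma lax_A_mat22:
  "lax_A \<epsilon>\<^sub>1 \<epsilon>\<^sub>2 x y z w q p t s T =
    mat22 (- \<epsilon>\<^sub>1 - 2 * z t s * T - 8 * p t s * T\<^sup>2) (- y t s - 4 * q t s * T + 8 * T\<^sup>2)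
          (x t s * T + 4 * w t s * T\<^sup>2 + 8 * T ^ 3) (- \<epsilon>\<^sub>2 + 2 * z t s * T + 8 * p t s * T\<^sup>2)"
  unfolding lax_A_def mat22_add mat22_smult mat22_uminus
  by (rule mat22_cong) (simp_all add: algebra_simps)

lemma lax_B1_mat22: "lax_B1 p t s T = mat22 (p t s) (- 1) (- T) (- p t s)"
  by (simp add: lax_B1_def mat22_add mat22_smult)

lemma lax_B3_mat22:
  "lax_B3 z w q p t s T =
    mat22 (z t s + 4 * p t s * T) (2 * q t s - 4 * T)
          (- 2 * w t s * T - 4 * T\<^sup>2) (- z t s - 4 * p t s * T)"
  unfolding lax_B3_def mat22_add mat22_smult by (rule mat22_cong) (simp_all add: algebra_simps)

text \<open>The inner functions \<open>f\<close> and \<open>g\<close> let one statement serve both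
  variables: one is taken as the identity and the other as a constant. The terms in
  \<open>\<epsilon>\<^sub>1\<close>, \<open>\<epsilon>\<^sub>2\<close> and the pure powers
  \<open>8 * T\<^sup>2\<close>, \<open>8 * T ^ 3\<close> differentiate to 0.\<close>

lemma mat_deriv_lax_A:
  assumes "((\<lambda>u. x (f u) (g u)) has_field_derivative x') (at u)"
    and "((\<lambda>u. y (f u) (g u)) has_field_derivative y') (at u)"
    and "((\<lambda>u. z (f u) (g u)) has_field_derivative z') (at u)"
    and "((\<lambda>u. w (f u) (g u)) has_field_derivative w') (at u)"
    and "((\<lambda>u. q (f u) (g u)) has_field_derivative q') (at u)"
    and "((\<lambda>u. p (f u) (g u)) has_field_derivative p') (at u)"
  shows "mat_deriv (\<lambda>u. lax_A \<epsilon>\<^sub>1 \<epsilon>\<^sub>2 x y z w q p (f u) (g u) T) u =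
    mat22 (- 2 * z' * T - 8 * p' * T\<^sup>2) (- y' - 4 * q' * T)
          (x' * T + 4 * w' * T\<^sup>2) (2 * z' * T + 8 * p' * T\<^sup>2)"
  unfolding lax_A_mat22
  by (rule mat_deriv_mat22; (rule derivative_eq_intros assms refl)+; simp)

lemma mat_deriv_lax_B1: "mat_deriv (\<lambda>T. lax_B1 p t s T) T = mat22 0 0 (- 1) 0"
  unfolding lax_B1_mat22
  by (rule mat_deriv_mat22; (rule derivative_eq_intros refl)+; simp)

lemma mat_deriv_lax_B3:
  "mat_deriv (\<lambda>T. lax_B3 z w q p t s T) T =
    mat22 (4 * p t s) (- 4) (- 2 * w t s - 8 * T) (- 4 * p t s)"
  unfolding lax_B3_mat22
  by (rule mat_deriv_mat22; (rule derivative_eq_intros refl)+; simp)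

text \<open>In the commutator the terms \<open>8 * T ^ 3\<close> cancel on the diagonal, and the
  multiples of \<open>p t s\<close> in degree 2 (upper right) and degree 3 (lower left) cancel too.
  Subtracting \<open>T\<close> times the derivative of \<open>lax_B1\<close> adds \<open>T\<close>
  to the lower left entry, which supplies the 1 in \<alpha>_0.\<close>

lemma lax_compatibility_t:
  assumes "\<And>f. f \<in> {x, y, z, w, q, p} \<Longrightarrow> (\<lambda>t'. f t' s) field_differentiable (at t)"
  shows "mat_deriv (\<lambda>t'. lax_A \<epsilon>\<^sub>1 \<epsilon>\<^sub>2 x y z w q p t' s T) t
      - T *\<^sub>m mat_deriv (\<lambda>T'. lax_B1 p t s T') T
      + commutator (lax_A \<epsilon>\<^sub>1 \<epsilon>\<^sub>2 x y z w q p t s T) (lax_B1 p t s T) =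
    residual (partial_t x t s - (- 2 * x t s * p t s - (1 - \<epsilon>\<^sub>1 + \<epsilon>\<^sub>2)))
             (partial_t y t s - (2 * y t s * p t s + (\<epsilon>\<^sub>1 - \<epsilon>\<^sub>2)))
             (partial_t z t s - (x t s + y t s) / 2)
             (partial_t w t s - (z t s - 2 * w t s * p t s))
             (partial_t q t s - (z t s + 2 * q t s * p t s))
             (partial_t p t s - (w t s + q t s) / 2) T"
proof -
  have D: "((\<lambda>t'. f t' s) has_field_derivative partial_t f t s) (at t)"
    if "f \<in> {x, y, z, w, q, p}" for f
    using assms[OF that] by (simp add: partial_t_def field_differentiable_derivI)
  have dA: "mat_deriv (\<lambda>t'. lax_A \<epsilon>\<^sub>1 \<epsilon>\<^sub>2 x y z w q p t' s T) t =
    mat22 (- 2 * partial_t z t s * T - 8 * partial_t p t s * T\<^sup>2)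
          (- partial_t y t s - 4 * partial_t q t s * T)
          (partial_t x t s * T + 4 * partial_t w t s * T\<^sup>2)
          (2 * partial_t z t s * T + 8 * partial_t p t s * T\<^sup>2)"
    \<comment> \<open>Unification takes \<open>f\<close> to be the identity and \<open>g\<close>
      constantly \<open>s\<close>.\<close>
    by (rule mat_deriv_lax_A; rule D; simp)
  show ?thesis
    \<comment> \<open>The derivatives are replaced while the Lax matrices are still folded, since
      these equations would no longer match after the next unfolding.\<close>
    unfolding dA mat_deriv_lax_B1
    unfolding lax_A_mat22 lax_B1_mat22 residual_def commutator_mat22 mat22_smult mat22_add mat22_diff
    by (rule mat22_cong)
       (simp_all add: field_simps power2_eq_square power3_eq_cube)
qed

text \<open>Here too the higher powers of \<open>T\<close> cancel in the commutator. The derivative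
  of \<open>lax_B3\<close> in \<open>T\<close> supplies the term \<open>- 2 * p t s\<close> in the
  equation for \<open>z\<close> and constants in those for \<open>w\<close> and \<open>q\<close>,
  which take the stated form because \<alpha>_0 + \<alpha>_1 = 1.\<close>

lemma lax_compatibility_s:
  assumes "\<And>f. f \<in> {x, y, z, w, q, p} \<Longrightarrow> (\<lambda>s'. f t s') field_differentiable (at s)"
  shows "mat_deriv (\<lambda>s'. lax_A \<epsilon>\<^sub>1 \<epsilon>\<^sub>2 x y z w q p t s' T) s
      - T *\<^sub>m mat_deriv (\<lambda>T'. lax_B3 z w q p t s T') T
      + commutator (lax_A \<epsilon>\<^sub>1 \<epsilon>\<^sub>2 x y z w q p t s T) (lax_B3 z w q p t s T) =
    residual
      (partial_s x t s - (- 2 * x t s * z t s - 2 * (1 - \<epsilon>\<^sub>1 + \<epsilon>\<^sub>2) * w t s))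
      (partial_s y t s - (2 * y t s * z t s - 2 * (\<epsilon>\<^sub>1 - \<epsilon>\<^sub>2) * q t s))
      (partial_s z t s - (- x t s * q t s + y t s * w t s - 2 * p t s))
      (partial_s w t s - (- 2 * x t s * p t s - 2 * (1 - \<epsilon>\<^sub>1 + \<epsilon>\<^sub>2) - (\<epsilon>\<^sub>1 - \<epsilon>\<^sub>2)))
      (partial_s q t s - (2 * y t s * p t s + (1 - \<epsilon>\<^sub>1 + \<epsilon>\<^sub>2) + 2 * (\<epsilon>\<^sub>1 - \<epsilon>\<^sub>2)))
      (partial_s p t s - (x t s + y t s) / 2) T"
proof -
  have D: "((\<lambda>s'. f t s') has_field_derivative partial_s f t s) (at s)"
    if "f \<in> {x, y, z, w, q, p}" for f
    using assms[OF that] by (simp add: partial_s_def field_differentiable_derivI)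
  have dA: "mat_deriv (\<lambda>s'. lax_A \<epsilon>\<^sub>1 \<epsilon>\<^sub>2 x y z w q p t s' T) s =
    mat22 (- 2 * partial_s z t s * T - 8 * partial_s p t s * T\<^sup>2)
          (- partial_s y t s - 4 * partial_s q t s * T)
          (partial_s x t s * T + 4 * partial_s w t s * T\<^sup>2)
          (2 * partial_s z t s * T + 8 * partial_s p t s * T\<^sup>2)"
    by (rule mat_deriv_lax_A; rule D; simp)
  show ?thesis
    unfolding dA mat_deriv_lax_B3
    unfolding lax_A_mat22 lax_B3_mat22 residual_def commutator_mat22 mat22_smult mat22_add mat22_diff
    by (rule mat22_cong)
       (simp_all add: field_simps power2_eq_square power3_eq_cube)
qed

theorem mainTheorem3:
  fixes \<epsilon>\<^sub>1 \<epsilon>\<^sub>2 \<alpha>\<^sub>0 \<alpha>\<^sub>1 :: complex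
    and x y z w q p :: "complex \<Rightarrow> complex \<Rightarrow> complex"
    and D :: "(complex \<times> complex) set"
    and A B\<^sub>1 B\<^sub>3 :: "complex \<Rightarrow> complex \<Rightarrow> complex \<Rightarrow> complex^2^2"
  assumes "\<alpha>\<^sub>0 = 1 - \<epsilon>\<^sub>1 + \<epsilon>\<^sub>2" and "\<alpha>\<^sub>1 = \<epsilon>\<^sub>1 - \<epsilon>\<^sub>2"
    and "open D"
    and "holomorphic2_on x D" and "holomorphic2_on y D" and "holomorphic2_on z D"
    and "holomorphic2_on w D" and "holomorphic2_on q D" and "holomorphic2_on p D"
    and "A = lax_A \<epsilon>\<^sub>1 \<epsilon>\<^sub>2 x y z w q p"
    and "B\<^sub>1 = lax_B1 p" and "B\<^sub>3 = lax_B3 z w q p"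
  shows "((\<forall>(t, s)\<in>D. \<forall>T.
             mat_deriv (\<lambda>t'. A t' s T) t - T *\<^sub>m mat_deriv (\<lambda>T'. B\<^sub>1 t s T') T
               + commutator (A t s T) (B\<^sub>1 t s T) = 0)
          \<longleftrightarrow>
          (\<forall>(t, s)\<in>D.
             partial_t x t s = - 2 * x t s * p t s - \<alpha>\<^sub>0 \<and>
             partial_t y t s = 2 * y t s * p t s + \<alpha>\<^sub>1 \<and>
             partial_t z t s = (x t s + y t s) / 2 \<and>
             partial_t w t s = z t s - 2 * w t s * p t s \<and>
             partial_t q t s = z t s + 2 * q t s * p t s \<and>
             partial_t p t s = (w t s + q t s) / 2))
       \<and>
         ((\<forall>(t, s)\<in>D. \<forall>T.
             mat_deriv (\<lambda>s'. A t s' T) s - T *\<^sub>m mat_deriv (\<lambda>T'. B\<^sub>3 t s T') T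
               + commutator (A t s T) (B\<^sub>3 t s T) = 0)
          \<longleftrightarrow>
          (\<forall>(t, s)\<in>D.
             partial_s x t s = - 2 * x t s * z t s - 2 * \<alpha>\<^sub>0 * w t s \<and>
             partial_s y t s = 2 * y t s * z t s - 2 * \<alpha>\<^sub>1 * q t s \<and>
             partial_s z t s = - x t s * q t s + y t s * w t s - 2 * p t s \<and>
             partial_s w t s = - 2 * x t s * p t s - 2 * \<alpha>\<^sub>0 - \<alpha>\<^sub>1 \<and>
             partial_s q t s = 2 * y t s * p t s + \<alpha>\<^sub>0 + 2 * \<alpha>\<^sub>1 \<and>
             partial_s p t s = (x t s + y t s) / 2))"
proof -
  have hol: "(\<lambda>t'. f t' s) field_differentiable (at t)" "(\<lambda>s'. f t s') field_differentiable (at s)"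
    if "(t, s) \<in> D" "f \<in> {x, y, z, w, q, p}" for f t s
    using that assms(4-9) by (auto simp: holomorphic2_on_def)
  show ?thesis
    unfolding assms(1,2,10-12)
    \<comment> \<open>Both equivalences already hold at each fixed point of \<open>D\<close>: there
      the condition for all \<open>T\<close> says that a \<open>residual\<close> vanishes
      identically, and \<open>right_minus_eq\<close> turns its vanishing differences into the
      evolution equations.\<close>
    by (intro conjI ball_cong refl; clarsimp simp only: split_paired_all prod.case
          lax_compatibility_t[OF hol(1)] lax_compatibility_s[OF hol(2)]
          residual_eq_0_iff right_minus_eq)
qed

end
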